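(* Assume that $\mathrm{non}(\mathcal{N})=\mathrm{cof}(\mathcal{N})$. Let $A\subset\mathbb{R}^2$ be a set of positive Lebesgue outer measure. Then there exists a partial bijection $f\subset A$ such that $f$, regarded as a subset of $\mathbb{R}^2$, avoids rational distances (i.e. for all $p,q\in f$ with $p\neq q$, the Euclidean distance $d(p,q)$ is irrational) and is full in $A$.
   Context: We work in ZFC. $\mathcal{N}$ denotes the $\sigma$-ideal of Lebesgue null sets. For a $\sigma$-ideal $\mathcal{I}$ of subsets of a space $X$, the cardinal coefficients are $$\mathrm{non}(\mathcal{I})=\min\{|A|: A\subset X\wedge A\notin\mathcal{I}\},$$ $$\mathrm{cof}(\mathcal{I})=\min\{|\mathcal{A}|: \mathcal{A}\subset\mathcal{I}\wedge(\forall I\in\mathcal{I})(\exists A'\in\mathcal{A})(I\subset A')\}.$$ Here $\mathcal{N}$ may be taken to be the ideal of null subsets of $X=\mathbb{R}$ (the values of these coefficients are the same for null subsets of $\mathbb{R}^2$). $d$ denotes the standard Euclidean metric on $\mathbb{R}^2$ and $\lambda^*$ denotes Lebesgue outer measure on $\mathbb{R}^2$. A set $f\subset A\subset\mathbb{R}^2$ is a partial bijection if there exists a set $A_1\subset\mathbb{R}$ such that $f$ is (the graph of) an injective function $f:A_1\to\mathbb{R}$ and $\{(x,f(x)):x\in A_1\}\subset A$. A set avoids rational distances (is an ARD set) if the distance between any two distinct points of it is irrational. For $B\subset A\subset\mathbb{R}^2$, the set $B$ is full in $A$ if for each Lebesgue measurable set $X\subset\mathbb{R}^2$ of positive measure we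 have $\lambda^*(X\cap A)=\lambda^*(X\cap B)$. *)

theory Defs
  imports "HOL-Analysis.Analysis"
begin

unbundle cardinal_syntax

text \<open>
  Cardinals are rendered as (isomorphism types of) well-orders, as in the library: \<open>|A|\<close> is the
  cardinal of \<open>A\<close>, and \<open>r =o s\<close>, \<open>r \<le>o s\<close> compare cardinals living on possibly different
  types. For a nonempty family \<open>F\<close>, \<open>min_card F\<close> is \<open>min {|A| : A \<in> F}\<close>.
\<close>

definition min_card :: "'a set set \<Rightarrow> 'a rel" where
  "min_card F = |SOME A. A \<in> F \<and> (\<forall>B\<in>F. |A| \<le>o |B| )|"

lemma min_card_is_minimum:
  assumes "F \<noteq> {}"
  shows "\<exists>A\<in>F. min_card F = |A|" and "\<forall>B\<in>F. min_card F \<le>o |B|"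
proof -
  have "\<exists>r\<in>card_of ` F. \<forall>s\<in>card_of ` F. r \<le>o s"
    using assms by (intro exists_minim_Card_order) (auto simp: card_of_Card_order)
  then have "\<exists>A. A \<in> F \<and> (\<forall>B\<in>F. |A| \<le>o |B| )"
    by auto
  from someI_ex[OF this]
  show "\<exists>A\<in>F. min_card F = |A|" and "\<forall>B\<in>F. min_card F \<le>o |B|"
    unfolding min_card_def by blast+
qed

definition non_ideal :: "'a set \<Rightarrow> 'a set set \<Rightarrow> 'a rel" where
  "non_ideal X \<I> = min_card {A. A \<subseteq> X \<and> A \<notin> \<I>}"

definition cof_ideal :: "'a set set \<Rightarrow> 'a set rel" where
  "cof_ideal \<I> = min_card {\<A>. \<A> \<subseteq> \<I> \<and> (\<forall>I\<in>\<I>. \<exists>A'\<in>\<A>. I \<subseteq> A')}"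

text \<open>\<open>lebesgue\<close> is the completion of \<open>lborel\<close>, so this ideal contains all subsets of Borel null sets.\<close>

abbreviation null_ideal :: "real set set" where
  "null_ideal \<equiv> null_sets lebesgue"

text \<open>
  The plane is \<^typ>\<open>real \<times> real\<close>, on which \<^const>\<open>dist\<close> is the Euclidean metric and
  \<open>outer_measure_of lebesgue\<close> is Lebesgue outer measure.
\<close>

definition partial_bijection_in :: "(real \<times> real) set \<Rightarrow> (real \<times> real) set \<Rightarrow> bool" where
  "partial_bijection_in A f \<longleftrightarrow>
     (\<exists>A\<^sub>1 g. inj_on g A\<^sub>1 \<and> f = {(x, g x) | x. x \<in> A\<^sub>1} \<and> f \<subseteq> A)"

definition avoids_rational_distances :: "'a::metric_space set \<Rightarrow> bool" where
  "avoids_rational_distances S \<longleftrightarrow> (\<forall>p\<in>S. \<forall>q\<in>S. p \<noteq> q \<longrightarrow> dist p q \<notin> \<rat>)"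

definition full_in :: "(real \<times> real) set \<Rightarrow> (real \<times> real) set \<Rightarrow> bool" where
  "full_in A B \<longleftrightarrow> B \<subseteq> A \<and>
     (\<forall>X\<in>sets lebesgue. emeasure lebesgue X > 0 \<longrightarrow>
        outer_measure_of lebesgue (X \<inter> A) = outer_measure_of lebesgue (X \<inter> B))"

end

theory Submission
  imports Defs
begin

text \<open>
  Let \<open>\<kappa> = non(N) = cof(N)\<close>. The points of \<open>f\<close> are chosen by transfinite recursion, one in each
  non-null intersection of \<open>A\<close> with a member of a family of \<open>\<kappa>\<close> sets that is dense among the sets
  of positive measure; this makes \<open>f\<close> full in \<open>A\<close>.

  Horizontal and vertical lines through fewer than \<open>\<kappa>\<close> points form a null set, but circles of
  rational radius around fewer than \<open>\<kappa>\<close> points need not. Two such circles with different centres,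
  however, meet in at most two points. Hence, up to a null set, the region which circles around one
  small set of centres obstruct cannot be obstructed again by circles around a disjoint small set.
  So there is a single small set \<open>U\<close> such that small sets disjoint from \<open>U\<close> obstruct nothing, and
  choosing all points of \<open>f\<close> outside \<open>U\<close> keeps the recursion going.
\<close>

subsection \<open>Small sets\<close>

text \<open>The type is left free so that sets of reals, sets of points and families of sets are all
  measured against non(N) of the line.\<close>

definition small :: "'a set \<Rightarrow> bool" where
  "small T \<longleftrightarrow> |T| <o non_ideal UNIV null_ideal"

lemma non_null_set_attained:
  obtains Z :: "real set" where "Z \<notin> null_ideal" "non_ideal UNIV null_ideal = |Z|"
proof -
  let ?F = "{A. A \<subseteq> (UNIV :: real set) \<and> A \<notin> null_ideal}"
  have "(UNIV :: real set) \<notin> null_ideal"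
    by (simp add: null_sets_def)
  then have "?F \<noteq> {}"
    by blast
  from min_card_is_minimum(1)[OF this] obtain Z where "Z \<in> ?F" "min_card ?F = |Z|"
    by blast
  then show ?thesis
    using that unfolding non_ideal_def by blast
qed

lemma small_if_card_le: "small S" if "|S| \<le>o |T|" "small T"
  using that ordLeq_ordLess_trans unfolding small_def by blast

lemma small_image: "small (f ` T)" if "small T"
  using that card_of_image small_if_card_le by blast

lemma small_real_null: "S \<in> null_ideal" if "small S"
proof (rule ccontr)
  assume "S \<notin> null_ideal"
  then have "S \<in> {A. A \<subseteq> (UNIV :: real set) \<and> A \<notin> null_ideal}"
    by simp
  then have "non_ideal UNIV null_ideal \<le>o |S|"
    unfolding non_ideal_def by (intro bspec[OF min_card_is_minimum(2)]) auto
  with \<open>small S\<close> show False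
    unfolding small_def using not_ordLess_ordLeq by blast
qed

text \<open>
  The cardinal \<open>non(N)\<close> has uncountable cofinality: otherwise a non-null set of that cardinality
  would be a countable union of small, hence null, sets.
\<close>

lemma small_UN:
  fixes T :: "nat \<Rightarrow> 'a set"
  assumes "\<And>n. small (T n)"
  shows "small (\<Union>n. T n)"
proof (rule ccontr)
  assume not_small: "\<not> small (\<Union>n. T n)"
  obtain Z :: "real set" where Z: "Z \<notin> null_ideal" "non_ideal UNIV null_ideal = |Z|"
    by (rule non_null_set_attained)
  have "|Z| \<le>o |\<Union>n. T n|"
    using not_small Z(2) card_of_Well_order not_ordLess_iff_ordLeq unfolding small_def by metis
  then obtain h where h: "inj_on h Z" "h ` Z \<subseteq> (\<Union>n. T n)"
    unfolding card_of_ordLeq[symmetric] by blast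
  have "{z \<in> Z. h z \<in> T n} \<in> null_ideal" for n
  proof (rule small_real_null, rule small_if_card_le[OF _ assms])
    have "inj_on h {z \<in> Z. h z \<in> T n}" "h ` {z \<in> Z. h z \<in> T n} \<subseteq> T n"
      using h by (auto intro: inj_on_subset)
    then show "|{z \<in> Z. h z \<in> T n}| \<le>o |T n|"
      using card_of_ordLeq by blast
  qed
  then have "(\<Union>n. {z \<in> Z. h z \<in> T n}) \<in> null_ideal"
    by (rule null_sets_UN)
  moreover have "Z = (\<Union>n. {z \<in> Z. h z \<in> T n})"
    using h by auto
  ultimately show False
    using Z by simp
qed

lemma small_Un: "small (S \<union> T)" if "small S" "small T"
proof -
  have "S \<union> T = (\<Union>n::nat. if n = 0 then S else T)"
    by (auto split: if_splits)
  then show ?thesis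
    using small_UN[of "\<lambda>n. if n = 0 then S else T"] that by simp
qed

text \<open>A strip over a Borel null set has product measure 0 times infinity, which is 0.
  Enclosing \<open>S\<close> in a Borel null set first supplies measurability.\<close>

lemma null_vimage_fst_snd:
  assumes "S \<in> null_ideal"
  shows "fst -` S \<in> null_sets (lebesgue :: (real \<times> real) measure)"
    and "snd -` S \<in> null_sets (lebesgue :: (real \<times> real) measure)"
proof -
  obtain N where N: "N \<in> null_sets lborel" "S \<subseteq> N"
    using assms unfolding null_sets_completion_iff2 by auto
  have [measurable]: "N \<in> sets borel" and em: "emeasure lborel N = 0"
    using N by (auto simp: null_sets_def)
  have "emeasure (lborel \<Otimes>\<^sub>M lborel) (N \<times> (UNIV :: real set)) = emeasure lborel N * emeasure lborel (UNIV :: real set)"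
       "emeasure (lborel \<Otimes>\<^sub>M lborel) ((UNIV :: real set) \<times> N) = emeasure lborel (UNIV :: real set) * emeasure lborel N"
    by (intro lborel.emeasure_pair_measure_Times; simp)+
  then have "emeasure (lborel \<Otimes>\<^sub>M lborel) (N \<times> (UNIV :: real set)) = 0"
       "emeasure (lborel \<Otimes>\<^sub>M lborel) ((UNIV :: real set) \<times> N) = 0"
    unfolding em by simp_all
  moreover have "N \<times> (UNIV :: real set) \<in> sets (lborel \<Otimes>\<^sub>M lborel)"
       "(UNIV :: real set) \<times> N \<in> sets (lborel \<Otimes>\<^sub>M lborel)"
    by (intro pair_measureI; simp)+
  ultimately have "N \<times> (UNIV :: real set) \<in> null_sets lborel"
      "(UNIV :: real set) \<times> N \<in> null_sets lborel"
    unfolding lborel_prod by (auto simp: null_sets_def)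
  moreover have "fst -` S \<subseteq> N \<times> (UNIV :: real set)" "snd -` S \<subseteq> (UNIV :: real set) \<times> N"
    using N by auto
  ultimately show "fst -` S \<in> null_sets (lebesgue :: (real \<times> real) measure)"
      "snd -` S \<in> null_sets (lebesgue :: (real \<times> real) measure)"
    unfolding null_sets_completion_iff2 by auto
qed

text \<open>The set lies in the strip over its first projection, which is small and hence null. Thus
  non(N) of the line also controls sets in the plane.\<close>

lemma small_plane_null:
  fixes T :: "(real \<times> real) set"
  assumes "small T"
  shows "T \<in> null_sets lebesgue"
proof (rule null_sets_completion_subset)
  show "fst -` fst ` T \<in> null_sets (lebesgue :: (real \<times> real) measure)"
    by (rule null_vimage_fst_snd(1)[OF small_real_null[OF small_image[OF assms]]])
qed auto

lemma countable_lebesgue_null: "countable S \<Longrightarrow> S \<in> null_sets lebesgue"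
  for S :: "'a::euclidean_space set"
  by (simp add: countable_imp_null_set_lborel null_sets_completionI)

section \<open>Points at rational distance from two centres\<close>

lemma finite_two_circles_coords:
  fixes a b c d r s :: real
  assumes "b \<noteq> d"
  shows "finite {(u, v). (u - a)\<^sup>2 + (v - b)\<^sup>2 = r \<and> (u - c)\<^sup>2 + (v - d)\<^sup>2 = s}" (is "finite ?S")
proof -
  \<comment> \<open>Subtracting the circle equations cancels the squares of \<open>u\<close> and
    \<open>v\<close>; as \<open>b \<noteq> d\<close>, the line
    \<open>v = \<alpha> + \<beta> * u\<close> remains. Substituting it into the first equation gives
    the quadratic \<open>?p\<close>.\<close>
  define \<beta> where "\<beta> = (a - c) / (d - b)"
  define \<alpha> where "\<alpha> = (r - s - a\<^sup>2 - b\<^sup>2 + c\<^sup>2 + d\<^sup>2) / (2 * (d - b))"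
  let ?p = "[:a\<^sup>2 + (\<alpha> - b)\<^sup>2 - r, 2 * (\<beta> * (\<alpha> - b) - a), 1 + \<beta>\<^sup>2:]"
  have "v = \<alpha> + \<beta> * u \<and> poly ?p u = 0" if "(u, v) \<in> ?S" for u v
  proof
    have 1: "(u - a)\<^sup>2 + (v - b)\<^sup>2 = r" and 2: "(u - c)\<^sup>2 + (v - d)\<^sup>2 = s"
      using that by auto
    have "2 * (d - b) * v = (r - s - a\<^sup>2 - b\<^sup>2 + c\<^sup>2 + d\<^sup>2) + 2 * (a - c) * u"
      using 1 2 by (simp add: power2_eq_square algebra_simps)
    then have "v = ((r - s - a\<^sup>2 - b\<^sup>2 + c\<^sup>2 + d\<^sup>2) + 2 * (a - c) * u) / (2 * (d - b))"
      using assms by (simp add: eq_divide_eq mult.commute)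
    then show v: "v = \<alpha> + \<beta> * u"
      unfolding \<alpha>_def \<beta>_def add_divide_distrib[of _ "2 * (a - c) * u"]
      by (simp del: right_diff_distrib_numeral)
    show "poly ?p u = 0"
      using 1 unfolding v by (simp add: power2_eq_square algebra_simps)
  qed
  then have "?S \<subseteq> (\<lambda>u. (u, \<alpha> + \<beta> * u)) ` {u. poly ?p u = 0}"
    by auto
  moreover have "1 + \<beta>\<^sup>2 \<noteq> 0"
    by (smt (verit) zero_le_power2)
  then have "finite {u. poly ?p u = 0}"
    by (intro poly_roots_finite) auto
  ultimately show ?thesis
    using finite_surj by blast
qed

lemma finite_two_circles:
  fixes p q :: "real \<times> real"
  assumes "p \<noteq> q"
  shows "finite {x. dist x p = r \<and> dist x q = s}" (is "finite ?S")
proof -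
  obtain a b c d where pq: "p = (a, b)" "q = (c, d)"
    by (cases p, cases q)
  let ?T = "\<lambda>a b c d. {(u, v). (u - a)\<^sup>2 + (v - b)\<^sup>2 = r\<^sup>2 \<and> (u - c)\<^sup>2 + (v - d)\<^sup>2 = s\<^sup>2}"
  have "?S \<subseteq> ?T a b c d"
    unfolding pq by (auto simp: dist_prod_def dist_real_def)
  \<comment> \<open>If only the first coordinates of the centres differ, reflection in the diagonal
    leads back to the case already treated.\<close>
  moreover have "?T a b c d = prod.swap ` ?T b a d c"
    by (auto simp: image_iff algebra_simps)
  moreover have "b \<noteq> d \<or> a \<noteq> c"
    using assms pq by auto
  ultimately show ?thesis
    using finite_two_circles_coords[of b d a "r\<^sup>2" c "s\<^sup>2"] finite_two_circles_coords[of a c b "r\<^sup>2" d "s\<^sup>2"]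
    by (metis (no_types, lifting) finite_imageI finite_subset)
qed

lemma countable_common_rational_neighbours:
  fixes p q :: "real \<times> real"
  assumes "p \<noteq> q"
  shows "countable {x. dist x p \<in> \<rat> \<and> dist x q \<in> \<rat>}"
proof -
  have "{x. dist x p \<in> \<rat> \<and> dist x q \<in> \<rat>} = (\<Union>r\<in>\<rat>. \<Union>s\<in>\<rat>. {x. dist x p = r \<and> dist x q = s})"
    by auto
  also have "countable \<dots>"
    using finite_two_circles[OF assms]
    by (intro countable_UN countable_rat countable_finite) auto
  finally show ?thesis .
qed

text \<open>Each pair of distinct centres contributes a countable set. Finitely many pairs give a
  countable union; an infinite \<open>T\<close> has at most \<open>|T|\<close> pairs, so the union
  is again small.\<close>

lemma small_two_rational_neighbours_null:
  fixes T :: "(real \<times> real) set"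
  assumes "small T"
  shows "{x. \<exists>p\<in>T. \<exists>q\<in>T. p \<noteq> q \<and> dist x p \<in> \<rat> \<and> dist x q \<in> \<rat>} \<in> null_sets lebesgue"
    (is "?S \<in> _")
proof -
  let ?I = "{(p, q). p \<in> T \<and> q \<in> T \<and> p \<noteq> q}"
  let ?A = "\<lambda>(p, q). {x. dist x p \<in> \<rat> \<and> dist x q \<in> \<rat>}"
  have S: "?S = (\<Union>i\<in>?I. ?A i)"
    unfolding UN_iff set_eq_iff by (simp add: Bex_def)
  have A: "countable (?A i)" if "i \<in> ?I" for i
    using that countable_common_rational_neighbours by auto
  show ?thesis
  proof (cases "finite T")
    case True
    have "finite ?I"
      by (rule finite_subset[of _ "T \<times> T"]) (use True in auto)
    then have "countable ?S"
      unfolding S by (rule countable_UN[OF countable_finite A])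
    then show ?thesis
      by (rule countable_lebesgue_null)
  next
    case False
    have "|?I| \<le>o |T \<times> T|"
      by (rule card_of_mono1) auto
    then have "|?I| \<le>o |T|"
      using card_of_Times_same_infinite[OF False] ordLeq_ordIso_trans by blast
    moreover have "\<forall>i\<in>?I. |?A i| \<le>o |T|"
    proof
      fix i assume "i \<in> ?I"
      then have "countable (?A i)"
        by (rule A)
      then have "|?A i| \<le>o |UNIV :: nat set|"
        unfolding countable_def card_of_ordLeq[symmetric] by auto
      also have "|UNIV :: nat set| \<le>o |T|"
        using False unfolding infinite_iff_card_of_nat .
      finally show "|?A i| \<le>o |T|" .
    qed
    ultimately have "|?S| \<le>o |T|"
      unfolding S by (rule card_of_UNION_ordLeq_infinite[OF False])
    then show ?thesis
      using assms by (intro small_plane_null) (rule small_if_card_le)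
  qed
qed

subsection \<open>Blocked sets\<close>

text \<open>Exhaustion: on each piece of finite measure a countable union of members attains the
  supremum of the measures, so any other member adds only a null set there. The union of these
  maximizers over all pieces serves everywhere.\<close>

lemma (in sigma_finite_measure) ex_essentially_largest:
  assumes \<B>: "\<B> \<subseteq> sets M" "{} \<in> \<B>" and UN: "\<And>F :: nat \<Rightarrow> 'a set. (\<And>n. F n \<in> \<B>) \<Longrightarrow> (\<Union>n. F n) \<in> \<B>"
  obtains E where "E \<in> \<B>" "\<And>D. D \<in> \<B> \<Longrightarrow> D - E \<in> null_sets M"
proof -
  obtain S :: "nat \<Rightarrow> 'a set" where S: "range S \<subseteq> sets M" "(\<Union>n. S n) = space M" "\<And>n. emeasure M (S n) \<noteq> \<infinity>"
    using sigma_finite by blast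
  have [measurable]: "S n \<in> sets M" for n
    using S by auto
  have [measurable]: "D \<in> sets M" if "D \<in> \<B>" for D
    using \<B> that by blast
  have Un: "C \<union> D \<in> \<B>" if "C \<in> \<B>" "D \<in> \<B>" for C D
  proof -
    have "C \<union> D = (\<Union>n::nat. if n = 0 then C else D)"
      by (auto split: if_splits)
    then show ?thesis
      using UN[of "\<lambda>n. if n = 0 then C else D"] that by simp
  qed
  have "\<exists>E\<in>\<B>. \<forall>D\<in>\<B>. emeasure M ((D - E) \<inter> S n) = 0" for n
  proof -
    let ?v = "\<lambda>D. emeasure M (D \<inter> S n)"
    obtain f :: "nat \<Rightarrow> ennreal" where f: "range f \<subseteq> ?v ` \<B>" "Sup (?v ` \<B>) = (SUP i. f i)"
      using ennreal_Sup_countable_SUP[of "?v ` \<B>"] \<B>(2) by auto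
    then have "\<forall>i. \<exists>D. D \<in> \<B> \<and> f i = ?v D"
      by blast
    then obtain D where D: "\<And>i. D i \<in> \<B>" "\<And>i. f i = ?v (D i)"
      by metis
    let ?E = "\<Union>i. D i"
    have E: "?E \<in> \<B>"
      using D UN by blast
    have "emeasure M ((C - ?E) \<inter> S n) = 0" if C: "C \<in> \<B>" for C
    proof -
      note [measurable] = C E
      have [measurable]: "C \<in> sets M" "?E \<in> sets M"
        using \<B>(1) C E by blast+
      have "?v (?E \<union> C) \<le> Sup (?v ` \<B>)"
        using Un[OF E C] by (intro SUP_upper)
      also have "\<dots> \<le> ?v ?E"
        unfolding f D by (intro SUP_least emeasure_mono) auto
      finally have "?v (?E \<union> C) \<le> ?v ?E" .
      moreover have "?v (?E \<union> C) = ?v ?E + emeasure M ((C - ?E) \<inter> S n)"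
        by (subst plus_emeasure) (auto intro!: arg_cong[where f="emeasure M"])
      moreover have "?v ?E \<le> emeasure M (S n)"
        by (intro emeasure_mono) auto
      then have "?v ?E \<noteq> \<infinity>"
        using S(3)[of n] by (auto simp: top_unique)
      ultimately show ?thesis
        by (metis add.right_neutral ennreal_add_left_cancel_le infinity_ennreal_def le_zero_eq)
    qed
    with E show ?thesis
      by blast
  qed
  then obtain E where E: "\<And>n. E n \<in> \<B>" "\<And>n D. D \<in> \<B> \<Longrightarrow> emeasure M ((D - E n) \<inter> S n) = 0"
    by metis
  show ?thesis
  proof
    show "(\<Union>n. E n) \<in> \<B>"
      using E(1) by (rule UN)
    fix D assume D: "D \<in> \<B>"
    have "(D - E n) \<inter> S n \<in> null_sets M" for n
      using E(2)[OF D, of n] D E(1)[of n] \<B>(1) by (auto simp: null_sets_def)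
    then have "(\<Union>n. (D - E n) \<inter> S n) \<in> null_sets M"
      by (rule null_sets_UN)
    moreover have "D - (\<Union>n. E n) \<in> sets M"
    proof (intro sets.Diff sets.countable_UN)
      show "D \<in> sets M" "range E \<subseteq> sets M"
        using D E(1) \<B>(1) by auto
    qed
    moreover have "D \<subseteq> (\<Union>n. S n)"
      unfolding S(2) using D \<B>(1) by (intro sets.sets_into_space) auto
    then have "D - (\<Union>n. E n) \<subseteq> (\<Union>n. (D - E n) \<inter> S n)"
      by blast
    ultimately show "D - (\<Union>n. E n) \<in> null_sets M"
      by (rule null_sets_subset)
  qed
qed

lemma sigma_finite_lebesgue: "sigma_finite_measure (lebesgue :: 'a::euclidean_space measure)"
proof
  obtain A :: "'a set set" where "countable A" "A \<subseteq> sets lborel" "\<Union>A = space lborel"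
      "\<forall>a\<in>A. emeasure lborel a \<noteq> \<infinity>"
    using lborel.sigma_finite_countable by blast
  then show "\<exists>A. countable A \<and> A \<subseteq> sets lebesgue \<and> \<Union>A = space (lebesgue :: 'a measure) \<and>
      (\<forall>a\<in>A. emeasure lebesgue a \<noteq> \<infinity>)"
    by (intro exI[of _ A]) auto
qed

text \<open>
  Call a measurable set blocked by a small set \<open>T\<close> if almost all points of \<open>A\<close> in it lie at a
  rational distance from \<open>T\<close>. There is an essentially largest blocked set, say blocked by \<open>U\<close>. A
  small set disjoint from \<open>U\<close> blocks nothing: otherwise a non-null set of points would have
  rational neighbours both in it and in \<open>U\<close>.
\<close>

lemma exceptional_small_set:
  fixes A :: "(real \<times> real) set"
  obtains U where "small U"
    "\<And>T D. \<lbrakk>small T; T \<inter> U = {}; D \<in> sets lebesgue; A \<inter> D \<notin> null_sets lebesgue\<rbrakk>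
      \<Longrightarrow> {x \<in> A \<inter> D. \<forall>t\<in>T. dist x t \<notin> \<rat>} \<notin> null_sets lebesgue"
proof -
  let ?free = "\<lambda>D T. {x \<in> A \<inter> D. \<forall>t\<in>T. dist x t \<notin> \<rat>}"
  define \<B> where "\<B> = {D \<in> sets lebesgue. \<exists>T. small T \<and> ?free D T \<in> null_sets lebesgue}"
  have "small ({} :: (real \<times> real) set)"
  proof -
    obtain Z :: "real set" where Z: "Z \<notin> null_ideal" "non_ideal UNIV null_ideal = |Z|"
      by (rule non_null_set_attained)
    then have "Z \<noteq> {}"
      by auto
    then show ?thesis
      unfolding small_def Z by (metis card_of_empty card_of_empty3 card_of_Well_order not_ordLess_iff_ordLeq)
  qed
  then have 1: "{} \<in> \<B>"
    unfolding \<B>_def by auto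
  have 2: "(\<Union>n. F n) \<in> \<B>" if F: "\<And>n. F n \<in> \<B>" for F :: "nat \<Rightarrow> _"
  proof -
    have "\<exists>T. small T \<and> ?free (F n) T \<in> null_sets lebesgue" for n
      using F[of n] unfolding \<B>_def by blast
    then obtain T where "\<forall>n. small (T n) \<and> ?free (F n) (T n) \<in> null_sets lebesgue"
      using choice[of "\<lambda>n T. small T \<and> ?free (F n) T \<in> null_sets lebesgue"] by auto
    then have T: "\<And>n. small (T n)" "\<And>n. ?free (F n) (T n) \<in> null_sets lebesgue"
      by auto
    have "?free (\<Union>n. F n) (\<Union>n. T n) \<subseteq> (\<Union>n. ?free (F n) (T n))"
      by auto
    moreover have "(\<Union>n. ?free (F n) (T n)) \<in> null_sets lebesgue"
      by (rule null_sets_UN) (rule T)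
    ultimately have "?free (\<Union>n. F n) (\<Union>n. T n) \<in> null_sets lebesgue"
      by (rule null_sets_completion_subset)
    moreover have "small (\<Union>n. T n)"
      by (rule small_UN) (rule T)
    moreover have "(\<Union>n. F n) \<in> sets lebesgue"
      using F unfolding \<B>_def by (intro sets.countable_UN) auto
    ultimately show ?thesis
      unfolding \<B>_def by blast
  qed
  have "\<B> \<subseteq> sets lebesgue"
    unfolding \<B>_def by blast
  from sigma_finite_measure.ex_essentially_largest[OF sigma_finite_lebesgue this 1 2]
  obtain E where E: "E \<in> \<B>" "\<And>D. D \<in> \<B> \<Longrightarrow> D - E \<in> null_sets lebesgue"
    by blast
  then obtain U where U: "small U" "?free E U \<in> null_sets lebesgue"
    unfolding \<B>_def by blast
  show ?thesis
  proof
    fix T D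
    assume T: "small T" "T \<inter> U = {}" and D: "D \<in> sets lebesgue" "A \<inter> D \<notin> null_sets lebesgue"
    show "?free D T \<notin> null_sets lebesgue"
    proof
      assume free: "?free D T \<in> null_sets lebesgue"
      let ?two = "{x. \<exists>p\<in>T \<union> U. \<exists>q\<in>T \<union> U. p \<noteq> q \<and> dist x p \<in> \<rat> \<and> dist x q \<in> \<rat>}"
      have "D \<in> \<B>"
        unfolding \<B>_def using D T free by blast
      then have "D - E \<in> null_sets lebesgue"
        by (rule E)
      moreover have "?two \<in> null_sets lebesgue"
        by (intro small_two_rational_neighbours_null small_Un T U)
      ultimately have "?free D T \<union> ?free E U \<union> (D - E) \<union> ?two \<in> null_sets lebesgue"
        using free U by (intro null_sets.Un)
      moreover have "A \<inter> D \<subseteq> ?free D T \<union> ?free E U \<union> (D - E) \<union> ?two"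
      proof
        fix x assume x: "x \<in> A \<inter> D"
        show "x \<in> ?free D T \<union> ?free E U \<union> (D - E) \<union> ?two"
        proof (rule ccontr)
          assume "\<not> ?thesis"
          then obtain p q where "p \<in> T" "dist x p \<in> \<rat>" "q \<in> U" "dist x q \<in> \<rat>" "x \<notin> ?two"
            using x by auto
          moreover from this have "p \<noteq> q"
            using T by blast
          ultimately show False
            by blast
        qed
      qed
      ultimately show False
        using D(2) null_sets_completion_subset[of "A \<inter> D"] by simp
    qed
  qed (rule U)
qed

subsection \<open>Dyadic squares and rational homotheties\<close>

text \<open>With floors, disjointness within a level is immediate and nesting becomes integer
  division by 2. Measurability and area come from the product form
  \<open>dyadic_square_eq\<close>.\<close>

definition dyadic_square :: "nat \<Rightarrow> int \<times> int \<Rightarrow> (real \<times> real) set" where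
  "dyadic_square n k = {p. \<lfloor>2 ^ n * fst p\<rfloor> = fst k \<and> \<lfloor>2 ^ n * snd p\<rfloor> = snd k}"

lemma dyadic_square_eq:
  "dyadic_square n k = {of_int (fst k) / 2 ^ n ..< (of_int (fst k) + 1) / 2 ^ n} \<times>
     {of_int (snd k) / 2 ^ n ..< (of_int (snd k) + 1) / 2 ^ n}"
  by (auto simp: dyadic_square_def floor_eq_iff field_simps)

lemma sets_dyadic_square [measurable]: "dyadic_square n k \<in> sets borel"
  unfolding dyadic_square_eq by (intro borel_Times) auto

lemma emeasure_dyadic_square: "emeasure lborel (dyadic_square n k) = ennreal (1 / 4 ^ n)"
proof -
  have "emeasure (lborel \<Otimes>\<^sub>M lborel) (dyadic_square n k) = ennreal (1 / 2 ^ n) * ennreal (1 / 2 ^ n)"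
    unfolding dyadic_square_eq
    by (subst lborel.emeasure_pair_measure_Times) (auto simp: field_simps)
  also have "\<dots> = ennreal (1 / 4 ^ n)"
    by (simp flip: ennreal_mult' power_mult_distrib)
  finally show ?thesis
    unfolding lborel_prod .
qed

lemma dyadic_square_refine:
  assumes "p \<in> dyadic_square n k"
  obtains l where "p \<in> dyadic_square (Suc n) l" "dyadic_square (Suc n) l \<subseteq> dyadic_square n k"
proof
  let ?l = "(\<lfloor>2 ^ Suc n * fst p\<rfloor>, \<lfloor>2 ^ Suc n * snd p\<rfloor>)"
  show "p \<in> dyadic_square (Suc n) ?l"
    by (simp add: dyadic_square_def)
  have half: "\<lfloor>2 ^ n * x\<rfloor> = \<lfloor>2 ^ Suc n * x\<rfloor> div 2" for x :: real
    using floor_divide_real_eq_div[of 2 "2 ^ Suc n * x"] by simp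
  show "dyadic_square (Suc n) ?l \<subseteq> dyadic_square n k"
    using assms unfolding dyadic_square_def half by auto
qed

lemma dist_dyadic_square:
  assumes "p \<in> dyadic_square n k" "q \<in> dyadic_square n k"
  shows "dist p q \<le> 2 / 2 ^ n"
proof -
  have "\<bar>fst p - fst q\<bar> \<le> 1 / 2 ^ n" "\<bar>snd p - snd q\<bar> \<le> 1 / 2 ^ n"
    using assms unfolding dyadic_square_eq by (auto simp: abs_le_iff add_divide_distrib)
  moreover have "dist p q \<le> \<bar>fst p - fst q\<bar> + \<bar>snd p - snd q\<bar>"
    unfolding dist_prod_def dist_real_def using sqrt_sum_squares_le_sum_abs by simp
  ultimately show ?thesis
    by simp
qed

text \<open>The squares of level \<open>n\<close> inside an open set are disjoint, and their union
  increases with \<open>n\<close> to the whole set. Countable additivity and a limit carry the bound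
  over.\<close>

lemma emeasure_open_le_if_dyadic_le:
  fixes U :: "(real \<times> real) set"
  assumes sets: "sets \<nu> = sets borel" and "open U"
    and le: "\<And>n k. emeasure \<nu> (dyadic_square n k) \<le> c * emeasure lborel (dyadic_square n k)"
  shows "emeasure \<nu> U \<le> c * emeasure lborel U"
proof -
  define K where "K n = {k. dyadic_square n k \<subseteq> U}" for n
  define V where "V n = (\<Union>k\<in>K n. dyadic_square n k)" for n
  have V: "emeasure \<mu> (V n) = (\<integral>\<^sup>+k. emeasure \<mu> (dyadic_square n k) \<partial>count_space (K n))"
    if "sets \<mu> = sets borel" for \<mu> n
    unfolding V_def
  proof (rule emeasure_UN_countable)
    show "disjoint_family_on (dyadic_square n) (K n)"
      by (auto simp: disjoint_family_on_def dyadic_square_def prod_eq_iff)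
  qed (use that in auto)
  have sets_V: "V n \<in> sets borel" for n
    unfolding V_def by (intro sets.countable_UN') auto
  have incseq: "incseq V"
  proof (rule incseq_SucI, rule subsetI)
    fix n p assume "p \<in> V n"
    then obtain k where k: "dyadic_square n k \<subseteq> U" "p \<in> dyadic_square n k"
      unfolding V_def K_def by auto
    then obtain l where "p \<in> dyadic_square (Suc n) l" "dyadic_square (Suc n) l \<subseteq> dyadic_square n k"
      using dyadic_square_refine by blast
    with k show "p \<in> V (Suc n)"
      unfolding V_def K_def by blast
  qed
  have U: "(\<Union>n. V n) = U"
  proof
    show "(\<Union>n. V n) \<subseteq> U"
      unfolding V_def K_def by auto
    show "U \<subseteq> (\<Union>n. V n)"
    proof
      fix p assume "p \<in> U"
      then obtain e where e: "e > 0" "ball p e \<subseteq> U"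
        using \<open>open U\<close> open_contains_ball by blast
      obtain n where n: "(1 / 2) ^ n < e / 2"
        using real_arch_pow_inv[of "e / 2" "1 / 2"] e by auto
      let ?k = "(\<lfloor>2 ^ n * fst p\<rfloor>, \<lfloor>2 ^ n * snd p\<rfloor>)"
      have p: "p \<in> dyadic_square n ?k"
        by (simp add: dyadic_square_def)
      have "dyadic_square n ?k \<subseteq> ball p e"
      proof
        fix q assume "q \<in> dyadic_square n ?k"
        from dist_dyadic_square[OF p this] n show "q \<in> ball p e"
          by (simp add: power_one_over)
      qed
      then show "p \<in> (\<Union>n. V n)"
        using p e unfolding V_def K_def by blast
    qed
  qed
  have "emeasure \<nu> U = (SUP n. emeasure \<nu> (V n))"
    unfolding U[symmetric] using incseq sets_V sets by (intro SUP_emeasure_incseq[symmetric]) auto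
  also have "\<dots> \<le> c * emeasure lborel U"
  proof (rule SUP_least)
    fix n
    have "emeasure \<nu> (V n) \<le> (\<integral>\<^sup>+k. c * emeasure lborel (dyadic_square n k) \<partial>count_space (K n))"
      unfolding V[OF sets] by (intro nn_integral_mono le)
    also have "\<dots> = c * emeasure lborel (V n)"
      unfolding V[OF sets_lborel] by (intro nn_integral_cmult) auto
    also have "\<dots> \<le> c * emeasure lborel U"
      using U \<open>open U\<close> by (intro mult_left_mono emeasure_mono) auto
    finally show "emeasure \<nu> (V n) \<le> c * emeasure lborel U" .
  qed
  finally show ?thesis .
qed

section \<open>Compact subsets and density in dyadic squares\<close>

lemma positive_contains_compact:
  fixes S :: "'a::euclidean_space set"
  assumes S: "S \<in> sets lebesgue" "emeasure lebesgue S > 0"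
  obtains C where "compact C" "C \<subseteq> S" "emeasure lborel C > 0"
proof -
  \<comment> \<open>A closed subset that loses measure less than \<open>e\<close> cannot be null;
    intersecting with a large ball makes it compact.\<close>
  obtain e :: real where e: "e > 0" "ennreal e < emeasure lebesgue S"
  proof (cases "emeasure lebesgue S")
    case (real m)
    then show ?thesis
      using S(2) that[of "m / 2"] by (simp add: ennreal_lessI)
  next
    case top
    then show ?thesis
      using that[of 1] by simp
  qed
  obtain T where T: "closed T" "T \<subseteq> S" "S - T \<in> lmeasurable" "emeasure lebesgue (S - T) < ennreal e"
    using sets_lebesgue_inner_closed[OF S(1) e(1)] .
  have "T \<notin> null_sets lborel"
  proof
    assume "T \<in> null_sets lborel"
    then have "emeasure lebesgue (S - T) = emeasure lebesgue S"
      by (intro emeasure_Diff_null_set null_sets_completionI S)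
    with T e show False
      by (auto dest: less_trans)
  qed
  moreover have "T = (\<Union>n::nat. T \<inter> cball 0 (real n))"
    by (auto simp: real_arch_simple)
  ultimately obtain n :: nat where n: "T \<inter> cball 0 (real n) \<notin> null_sets lborel"
    using null_sets_UN[of "\<lambda>n::nat. T \<inter> cball 0 (real n)" lborel] by auto
  show ?thesis
  proof
    show "compact (T \<inter> cball 0 (real n))"
      using T by (intro closed_Int_compact) auto
    show "emeasure lborel (T \<inter> cball 0 (real n)) > 0"
      using n T by (auto simp: null_sets_def zero_less_iff_neq_zero)
  qed (use T in auto)
qed

text \<open>This stands in for the Lebesgue density theorem. If the density were at most
  \<open>c\<close> in every square, a compact \<open>C\<close> inside \<open>S\<close> would have
  measure at most \<open>c\<close> times that of every open set around it, which fails for open sets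
  close to \<open>C\<close> in measure.\<close>

lemma dense_in_dyadic_square:
  fixes S :: "(real \<times> real) set"
  assumes S: "S \<in> sets lebesgue" "emeasure lebesgue S > 0" and c: "c < 1"
  obtains n k where "emeasure lebesgue (S \<inter> dyadic_square n k) > ennreal (c / 4 ^ n)"
proof (rule ccontr)
  assume "\<not> thesis"
  then have le: "emeasure lebesgue (S \<inter> dyadic_square n k) \<le> ennreal (c / 4 ^ n)" for n k
    using that not_le by blast
  obtain C where C: "compact C" "C \<subseteq> S" "emeasure lborel C > 0"
    using positive_contains_compact[OF S] .
  note [measurable] = borel_compact[OF C(1)]
  define \<nu> where "\<nu> = density lborel (indicator C)"
  have \<nu>: "emeasure \<nu> B = emeasure lborel (C \<inter> B)" if "B \<in> sets borel" for B
    using that unfolding \<nu>_def by (subst emeasure_density) (auto simp flip: indicator_inter_arith)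
  have \<nu>_le: "emeasure \<nu> (dyadic_square n k) \<le> ennreal c * emeasure lborel (dyadic_square n k)" for n k
  proof -
    have "emeasure \<nu> (dyadic_square n k) = emeasure lebesgue (C \<inter> dyadic_square n k)"
      by (simp add: \<nu>)
    also have "\<dots> \<le> emeasure lebesgue (S \<inter> dyadic_square n k)"
      using C S by (intro emeasure_mono) auto
    also note le
    finally show ?thesis
      unfolding emeasure_dyadic_square by (simp add: divide_inverse ennreal_mult'')
  qed
  have "emeasure lborel C < \<infinity>"
    using emeasure_compact_finite[OF C(1)] by simp
  then obtain m where m: "emeasure lborel C = ennreal m" "m > 0"
    using C(3) by (cases "emeasure lborel C") (auto simp: ennreal_less_zero_iff)
  \<comment> \<open>Chosen so that the upper bound falls short of \<open>m\<close> by
    \<open>m * (1 - max c 0)\<^sup>2\<close>; the maximum covers negative \<open>c\<close>.\<close>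
  define e where "e = m * (1 - max c 0)"
  have e: "e > 0"
    using m c by (simp add: e_def)
  obtain U where U: "open U" "C \<subseteq> U" "emeasure lborel (U - C) < ennreal e"
    using outer_regular_lborel[of C e] e by auto
  have "emeasure lborel C = emeasure \<nu> U"
    using U by (simp add: \<nu> Int_absorb2)
  also have "\<dots> \<le> ennreal c * emeasure lborel U"
    by (rule emeasure_open_le_if_dyadic_le[OF _ U(1) \<nu>_le]) (simp add: \<nu>_def)
  also have "emeasure lborel U = emeasure lborel C + emeasure lborel (U - C)"
    using U by (subst plus_emeasure) (auto intro!: arg_cong[where f="emeasure lborel"])
  also have "ennreal c * \<dots> \<le> ennreal (max c 0) * (ennreal m + ennreal e)"
    unfolding m using U by (intro mult_mono add_left_mono ennreal_leI) auto
  also have "\<dots> = ennreal (max c 0 * (m + e))"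
    using m e by (simp add: ennreal_mult')
  also have "\<dots> < ennreal m"
  proof (rule ennreal_lessI)
    let ?c = "max c 0"
    have "m - ?c * (m + e) = m * (1 - ?c)\<^sup>2"
      unfolding e_def by (simp add: power2_eq_square algebra_simps)
    moreover have "m * (1 - ?c)\<^sup>2 > 0"
      using m c by simp
    ultimately show "?c * (m + e) < m"
      by simp
  qed (use m in simp)
  finally show False
    using m by simp
qed

text \<open>
  The rational homotheties act ergodically: they map any dyadic square onto any other one, and two
  sets that each fill most of the same dyadic square meet.
\<close>

lemma rational_homotheties_conull:
  fixes Y :: "(real \<times> real) set"
  assumes Y: "compact Y" "emeasure lborel Y > 0"
  shows "- (\<Union>c\<in>\<rat> - {0}. \<Union>b\<in>\<rat> \<times> \<rat>. (\<lambda>y. c *\<^sub>R y + b) ` Y) \<in> null_sets lborel"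
    (is "- ?H \<in> _")
proof (rule ccontr)
  assume not_null: "- ?H \<notin> null_sets lborel"
  have H [measurable]: "?H \<in> sets borel"
    by (intro sets.countable_UN'' countable_Diff countable_rat countable_SIGMA borel_compact
        compact_continuous_image Y continuous_intros)
  define Z where "Z = - ?H"
  have Z [measurable]: "Z \<in> sets borel"
    unfolding Z_def using borel_comp[OF H] .
  moreover have "Z \<notin> null_sets lborel"
    using not_null unfolding Z_def .
  ultimately have "emeasure lebesgue Z > 0"
    by (auto simp: null_sets_def zero_less_iff_neq_zero)
  \<comment> \<open>The density 3/4 exceeds one half, so two disjoint sets of this density do not
    fit into one square.\<close>
  then obtain n k where nk: "emeasure lebesgue (Z \<inter> dyadic_square n k) > ennreal ((3/4) / 4 ^ n)"
    using dense_in_dyadic_square[of Z "3/4"] by auto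
  note [measurable] = borel_compact[OF Y(1)]
  have "emeasure lebesgue Y > 0"
    using Y by simp
  then obtain m l where ml: "emeasure lebesgue (Y \<inter> dyadic_square m l) > ennreal ((3/4) / 4 ^ m)"
    using dense_in_dyadic_square[of Y "3/4"] by auto
  \<comment> \<open>\<open>c\<close> is the ratio of the side lengths and \<open>b\<close> aligns
    the corners, so \<open>?h\<close> carries \<open>dyadic_square m l\<close> into
    \<open>dyadic_square n k\<close>.\<close>
  define c :: real where "c = 2 ^ m / 2 ^ n"
  define b :: "real \<times> real" where "b = (of_int (fst k - fst l) / 2 ^ n, of_int (snd k - snd l) / 2 ^ n)"
  let ?h = "\<lambda>y. c *\<^sub>R y + b"
  let ?Y = "?h ` (Y \<inter> dyadic_square m l)"
  have "c \<in> \<rat> - {0}" "b \<in> \<rat> \<times> \<rat>"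
    unfolding c_def b_def by auto
  then have "?h ` Y \<subseteq> ?H"
    by blast
  then have disj: "?Y \<inter> (Z \<inter> dyadic_square n k) = {}"
    unfolding Z_def by blast
  have sub: "?Y \<subseteq> dyadic_square n k"
    unfolding dyadic_square_def b_def c_def by (auto simp: distrib_left)
  have "?Y = (\<lambda>z. (1 / c) *\<^sub>R (z - b)) -` (Y \<inter> dyadic_square m l)"
    by (auto simp: image_iff c_def intro!: bexI[of _ "(1 / c) *\<^sub>R (_ - b)"])
  then have sets_Y: "?Y \<in> sets borel"
    using measurable_sets_borel[of "\<lambda>z. (1 / c) *\<^sub>R (z - b)" borel "Y \<inter> dyadic_square m l"] by simp
  have four: "(2 ^ i)\<^sup>2 = (4 :: real) ^ i" for i :: nat
    by (simp add: power2_eq_square flip: power_mult_distrib)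
  have "ennreal ((3/4) / 4 ^ n) = ennreal (c ^ 2) * ennreal ((3/4) / 4 ^ m)"
    unfolding c_def by (simp add: power_divide four flip: ennreal_mult'')
  also have "\<dots> < ennreal (c ^ 2) * emeasure lebesgue (Y \<inter> dyadic_square m l)"
    using ml by (intro ennreal_mult_strict_left_mono) (auto simp: c_def)
  also have "\<dots> = emeasure lebesgue ?Y"
    using emeasure_lebesgue_affine[of c b "Y \<inter> dyadic_square m l"]
    by (simp add: add.commute power2_eq_square ennreal_mult' c_def)
  finally have "ennreal ((3/4) / 4 ^ n) + ennreal ((3/4) / 4 ^ n) \<le>
      emeasure lebesgue ?Y + emeasure lebesgue (Z \<inter> dyadic_square n k)"
    using nk by (intro add_mono) auto
  also have "\<dots> = emeasure lebesgue (?Y \<union> (Z \<inter> dyadic_square n k))"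
    using disj sets_Y by (intro plus_emeasure) auto
  also have "\<dots> \<le> emeasure lebesgue (dyadic_square n k)"
    using sub by (intro emeasure_mono) auto
  also have "\<dots> = ennreal (1 / 4 ^ n)"
    by (simp add: emeasure_dyadic_square)
  finally show False
    by (simp add: field_simps flip: ennreal_plus)
qed

subsection \<open>Splitting binary digits\<close>

text \<open>
  A pair of integers whose components are the first \<open>n\<close> binary digits of \<open>x\<close> in odd and in even
  position, read as binary numbers; in the limit this splits \<open>[0, 1)\<close> into a square.
\<close>

primrec split_digits :: "nat \<Rightarrow> real \<Rightarrow> int \<times> int" where
  "split_digits 0 x = (0, 0)"
| "split_digits (Suc n) x =
     (2 * fst (split_digits n x) + \<lfloor>2 * 4 ^ n * x\<rfloor> mod 2,
      2 * snd (split_digits n x) + \<lfloor>4 * 4 ^ n * x\<rfloor> mod 2)"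

definition to_square :: "real \<Rightarrow> real \<times> real" where
  "to_square x = (lim (\<lambda>n. of_int (fst (split_digits n x)) / 2 ^ n),
     lim (\<lambda>n. of_int (snd (split_digits n x)) / 2 ^ n))"

text \<open>Left ends increase and right ends decrease, so the limit exists and lies in every
  interval. The right end is included because all later digits may be 1.\<close>

lemma binary_expansion_limit:
  fixes a :: "nat \<Rightarrow> int"
  assumes "\<And>n. 2 * a n \<le> a (Suc n)" "\<And>n. a (Suc n) \<le> 2 * a n + 1"
  shows "lim (\<lambda>n. of_int (a n) / 2 ^ n) \<in> {of_int (a n) / 2 ^ n .. (of_int (a n) + 1) / 2 ^ n :: real}"
proof -
  let ?X = "\<lambda>n. of_int (a n) / 2 ^ n :: real"
  let ?Y = "\<lambda>n. (of_int (a n) + 1) / 2 ^ n :: real"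
  have X: "incseq ?X"
  proof (rule incseq_SucI)
    fix n
    have "2 * of_int (a n) \<le> (of_int (a (Suc n)) :: real)"
      using assms(1)[of n] by linarith
    then show "?X n \<le> ?X (Suc n)"
      by (simp add: field_simps)
  qed
  have Y: "decseq ?Y"
  proof (rule decseq_SucI)
    fix n
    have "(of_int (a (Suc n)) :: real) \<le> 2 * of_int (a n) + 1"
      using assms(2)[of n] by linarith
    then have "?Y (Suc n) \<le> (2 * (of_int (a n) + 1)) / 2 ^ Suc n"
      by (intro divide_right_mono) auto
    also have "\<dots> = ?Y n"
      by (simp del: distrib_left_numeral)
    finally show "?Y (Suc n) \<le> ?Y n" .
  qed
  have XY: "?X m \<le> ?Y n" if "m \<ge> n" for m n
  proof -
    have "?X m \<le> ?Y m"
      by (simp add: divide_right_mono)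
    also have "\<dots> \<le> ?Y n"
      using Y that by (rule decseqD)
    finally show ?thesis .
  qed
  obtain L where L: "?X \<longlonglongrightarrow> L" "\<forall>i. ?X i \<le> L"
    using incseq_convergent[OF X, of "?Y 0"] XY[of 0] by auto
  moreover have "L \<le> ?Y n"
    using L(1) XY by (intro LIMSEQ_le_const2) auto
  ultimately show ?thesis
    using limI[OF L(1)] by auto
qed

lemma to_square_bounds:
  "fst (to_square x) \<in> {of_int (fst (split_digits n x)) / 2 ^ n .. (of_int (fst (split_digits n x)) + 1) / 2 ^ n}"
  "snd (to_square x) \<in> {of_int (snd (split_digits n x)) / 2 ^ n .. (of_int (snd (split_digits n x)) + 1) / 2 ^ n}"
  unfolding to_square_def fst_conv snd_conv by (rule binary_expansion_limit; simp)+

text \<open>The two components together hold the first \<open>2 * n\<close> binary digits of a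
  number in [0, 1). The induction recovers the floor from its quotient by 4 and its last two
  bits.\<close>

lemma split_digits_determine_floor:
  assumes "x \<in> {0..<1}" "y \<in> {0..<1}" "split_digits n x = split_digits n y"
  shows "\<lfloor>4 ^ n * x\<rfloor> = \<lfloor>4 ^ n * y\<rfloor>"
  using assms(3)
proof (induction n)
  case 0
  then show ?case
    using assms(1,2) floor_unique[of 0 x] floor_unique[of 0 y] by simp
next
  case (Suc n)
  let ?f = "\<lambda>x. \<lfloor>4 ^ Suc n * x\<rfloor>"
  have f: "\<lfloor>2 * 4 ^ n * z\<rfloor> = ?f z div 2" "\<lfloor>4 ^ n * z\<rfloor> = ?f z div 4" "\<lfloor>4 * 4 ^ n * z\<rfloor> = ?f z" for z :: real
    using floor_divide_real_eq_div[of 2 "4 ^ Suc n * z"] floor_divide_real_eq_div[of 4 "4 ^ Suc n * z"]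
    by (simp_all add: mult_ac)
  have digits: "a = b \<and> d mod 2 = e mod 2" if "2 * a + d mod 2 = 2 * b + e mod 2" for a b d e :: int
    using that by presburger
  have eq: "2 * fst (split_digits n x) + (?f x div 2) mod 2 = 2 * fst (split_digits n y) + (?f y div 2) mod 2"
    "2 * snd (split_digits n x) + ?f x mod 2 = 2 * snd (split_digits n y) + ?f y mod 2"
    using Suc.prems unfolding split_digits.simps f by simp_all
  have "split_digits n x = split_digits n y" "(?f x div 2) mod 2 = (?f y div 2) mod 2" "?f x mod 2 = ?f y mod 2"
    using digits[OF eq(1)] digits[OF eq(2)] by (simp_all add: prod_eq_iff)
  moreover from this(1) have "?f x div 4 = ?f y div 4"
    unfolding f(2)[symmetric] by (rule Suc.IH)
  moreover have "i = j" if "(i div 2) mod 2 = (j div 2) mod 2" "i mod 2 = j mod 2" "i div 4 = j div 4" for i j :: int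
  proof -
    have "l div 2 div 2 = l div 4" for l :: int
      by (simp flip: zdiv_zmult2_eq)
    then show ?thesis
      using that div_mult_mod_eq[of "i div 2" 2] div_mult_mod_eq[of "j div 2" 2]
        div_mult_mod_eq[of i 2] div_mult_mod_eq[of j 2] by metis
  qed
  ultimately show ?case
    by blast
qed

section \<open>Measure and continuity properties of the digit map\<close>

lemma measurable_split_digits [measurable]:
  "(\<lambda>x. fst (split_digits n x)) \<in> borel \<rightarrow>\<^sub>M count_space UNIV"
  "(\<lambda>x. snd (split_digits n x)) \<in> borel \<rightarrow>\<^sub>M count_space UNIV"
  by (induction n) simp_all

lemma measurable_to_square [measurable]: "to_square \<in> borel \<rightarrow>\<^sub>M borel"
  unfolding to_square_def by (intro borel_measurable_Pair borel_measurable_lim_metric) measurable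

lemma emeasure_split_digits_le:
  "emeasure lborel {x \<in> {0..<1}. split_digits n x = k} \<le> ennreal (1 / 4 ^ n)"
proof (cases "{x \<in> {0..<1}. split_digits n x = k} = {}")
  case False
  then obtain y where y: "y \<in> {0..<1}" "split_digits n y = k"
    by auto
  let ?m = "of_int \<lfloor>4 ^ n * y\<rfloor> :: real"
  have "x \<in> {?m / 4 ^ n .. (?m + 1) / 4 ^ n}" if "x \<in> {0..<1}" "split_digits n x = k" for x
    using split_digits_determine_floor[of x y n] that y floor_eq_iff[of "4 ^ n * x" "\<lfloor>4 ^ n * y\<rfloor>"]
    by (simp add: field_simps)
  then have "emeasure lborel {x \<in> {0..<1}. split_digits n x = k} \<le> emeasure lborel {?m / 4 ^ n .. (?m + 1) / 4 ^ n}"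
    by (intro emeasure_mono) auto
  also have "\<dots> = ennreal (1 / 4 ^ n)"
    by (simp add: divide_right_mono flip: diff_divide_distrib)
  finally show ?thesis .
qed (simp only: emeasure_empty zero_le)

text \<open>The image \<open>\<nu>\<close> of Lebesgue measure on [0, 1) is at most 4 times Lebesgue
  measure on dyadic squares, hence on open sets. Open covers of small measure then make
  \<open>\<nu>\<close> vanish on null sets.\<close>

lemma null_vimage_to_square:
  assumes "M \<in> null_sets lebesgue"
  shows "{x \<in> {0..<1}. to_square x \<in> M} \<in> null_sets lebesgue"
proof -
  obtain B where B: "B \<in> null_sets lborel" "M \<subseteq> B"
    using assms unfolding null_sets_completion_iff2 by auto
  then have [measurable]: "B \<in> sets borel" and B0: "emeasure lborel B = 0"
    by (auto simp: null_sets_def)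
  define \<nu> where "\<nu> = distr (density lborel (indicator {0..<1})) borel to_square"
  have \<nu>: "emeasure \<nu> S = emeasure lborel {x \<in> {0..<1}. to_square x \<in> S}" if [measurable]: "S \<in> sets borel" for S
  proof -
    have [measurable]: "to_square -` S \<in> sets borel"
      using measurable_sets_borel[OF measurable_to_square that] .
    have "emeasure \<nu> S = (\<integral>\<^sup>+x. indicator {0..<1} x * indicator (to_square -` S) x \<partial>lborel)"
      unfolding \<nu>_def by (subst emeasure_distr) (auto simp: emeasure_density)
    also have "\<dots> = (\<integral>\<^sup>+x. indicator {x \<in> {0..<1}. to_square x \<in> S} x \<partial>lborel)"
      by (intro nn_integral_cong) (auto simp: indicator_def)
    also have "\<dots> = emeasure lborel {x \<in> {0..<1}. to_square x \<in> S}"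
      by (intro nn_integral_indicator) simp
    finally show ?thesis .
  qed
  have \<nu>_le: "emeasure \<nu> (dyadic_square n k) \<le> 4 * emeasure lborel (dyadic_square n k)" for n k
  proof -
    \<comment> \<open>The value of \<open>to_square\<close> may be the right end of its digit
      interval, so each coordinate allows two digit values. The four pairs give the factor
      4.\<close>
    let ?J = "{fst k - 1, fst k} \<times> {snd k - 1, snd k}"
    have digits: "{x \<in> {0..<1}. split_digits n x = j} \<in> sets borel" for j
      by (simp add: prod_eq_iff)
    have near: "m \<in> {l - 1, l}"
      if "of_int m / 2 ^ n \<le> z" "z \<le> (of_int m + 1) / 2 ^ n" "\<lfloor>2 ^ n * z\<rfloor> = l" for m l :: int and z :: real
    proof -
      have "of_int m \<le> 2 ^ n * z" "2 ^ n * z \<le> of_int m + 1"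
        using that(1,2) by (simp_all add: field_simps)
      then show ?thesis
        using that(3) by (simp add: floor_eq_iff) linarith
    qed
    have "split_digits n x \<in> ?J" if "to_square x \<in> dyadic_square n k" for x
      using near[of "fst (split_digits n x)" "fst (to_square x)" "fst k"]
        near[of "snd (split_digits n x)" "snd (to_square x)" "snd k"]
        to_square_bounds[of x n] that unfolding dyadic_square_def mem_Times_iff by simp
    then have "{x \<in> {0..<1}. to_square x \<in> dyadic_square n k} \<subseteq> (\<Union>j\<in>?J. {x \<in> {0..<1}. split_digits n x = j})"
      by blast
    then have "emeasure \<nu> (dyadic_square n k) \<le> emeasure lborel (\<Union>j\<in>?J. {x \<in> {0..<1}. split_digits n x = j})"
      unfolding \<nu>[OF sets_dyadic_square] using digits by (intro emeasure_mono) auto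
    also have "\<dots> \<le> (\<Sum>j\<in>?J. emeasure lborel {x \<in> {0..<1}. split_digits n x = j})"
      using digits by (intro emeasure_subadditive_finite) auto
    also have "\<dots> \<le> of_nat (card ?J) * ennreal (1 / 4 ^ n)"
      by (intro sum_bounded_above emeasure_split_digits_le)
    also have "card ?J = 4"
      unfolding card_cartesian_product by simp
    finally show ?thesis
      by (simp add: emeasure_dyadic_square)
  qed
  have "emeasure \<nu> B \<le> 0 + ennreal e" if e: "e > 0" for e :: real
  proof -
    obtain U where U: "open U" "B \<subseteq> U" "emeasure lborel (U - B) < ennreal (e / 4)"
      using outer_regular_lborel[of B "e / 4"] e by auto
    have "emeasure lborel (U - B) = emeasure lborel U"
      using U B(1) by (intro emeasure_Diff_null_set) auto
    have "emeasure \<nu> B \<le> emeasure \<nu> U"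
      using U by (intro emeasure_mono) (auto simp: \<nu>_def)
    also have "\<dots> \<le> 4 * emeasure lborel U"
      by (rule emeasure_open_le_if_dyadic_le[OF _ U(1) \<nu>_le]) (simp add: \<nu>_def)
    also have "\<dots> \<le> 4 * ennreal (e / 4)"
      using U \<open>emeasure lborel (U - B) = emeasure lborel U\<close> by (intro mult_left_mono) auto
    also have "\<dots> = ennreal e"
      using ennreal_mult'[of 4 "e / 4"] by simp
    finally show ?thesis
      by simp
  qed
  then have "emeasure \<nu> B \<le> 0"
    by (rule ennreal_le_epsilon)
  then have "{x \<in> {0..<1}. to_square x \<in> B} \<in> null_sets lborel"
    using \<nu>[of B] by (simp add: null_sets_def)
  moreover have "{x \<in> {0..<1}. to_square x \<in> M} \<subseteq> {x \<in> {0..<1}. to_square x \<in> B}"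
    using B by auto
  ultimately show ?thesis
    unfolding null_sets_completion_iff2 by auto
qed

text \<open>Nonzero rational multiples of an irrational are never integers, so every floor in the
  recursion is locally constant at \<open>x\<close>.\<close>

lemma eventually_split_digits_eq:
  assumes "x \<notin> \<rat>"
  shows "\<forall>\<^sub>F y in at x. split_digits n y = split_digits n x"
proof (induction n)
  case (Suc n)
  have floor: "\<forall>\<^sub>F y in at x. \<lfloor>c * y\<rfloor> = \<lfloor>c * x\<rfloor>" if "c \<in> \<rat>" "c \<noteq> 0" for c :: real
  proof (rule eventually_floor_eq)
    show "((\<lambda>y. c * y) \<longlongrightarrow> c * x) (at x)"
      by (intro tendsto_intros)
    show "c * x \<notin> \<int>"
    proof
      assume "c * x \<in> \<int>"
      then have "c * x / c \<in> \<rat>"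
        using that Ints_subset_Rats by (intro Rats_divide) auto
      with assms that show False
        by simp
    qed
  qed
  from Suc floor[of "2 * 4 ^ n"] floor[of "4 * 4 ^ n"] show ?case
    by (simp, elim eventually_rev_mp) (auto intro!: always_eventually)
qed simp

text \<open>Near \<open>x\<close> the first digits are constant, which confines both values to one
  square of side \<open>1 / 2 ^ n\<close>. Hence compact sets of irrationals have compact
  images.\<close>

lemma isCont_to_square:
  assumes "x \<notin> \<rat>"
  shows "isCont to_square x"
  unfolding isCont_def
proof (rule tendstoI)
  fix e :: real assume "e > 0"
  then obtain n where n: "(1 / 2) ^ n < e / 2"
    using real_arch_pow_inv[of "e / 2" "1 / 2"] by auto
  show "\<forall>\<^sub>F y in at x. dist (to_square y) (to_square x) < e"
    using eventually_split_digits_eq[OF assms, of n]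
  proof eventually_elim
    case (elim y)
    have close: "\<bar>s - t\<bar> \<le> 1 / 2 ^ n"
      if "s \<in> {a / 2 ^ n .. (a + 1) / 2 ^ n}" "t \<in> {a / 2 ^ n .. (a + 1) / 2 ^ n}" for s t a :: real
      using that by (auto simp: abs_le_iff add_divide_distrib)
    have "dist (to_square y) (to_square x)
        \<le> \<bar>fst (to_square y) - fst (to_square x)\<bar> + \<bar>snd (to_square y) - snd (to_square x)\<bar>"
      unfolding dist_prod_def dist_real_def using sqrt_sum_squares_le_sum_abs by simp
    also have "\<dots> \<le> 1 / 2 ^ n + 1 / 2 ^ n"
      using to_square_bounds[of y n] to_square_bounds[of x n] unfolding elim
      by (intro add_mono close)
    finally show ?case
      using n by (simp add: power_one_over)
  qed
qed

subsection \<open>A dense family of sets of positive measure\<close>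

text \<open>Otherwise every \<open>F - G\<close> would be relatively open and dense in
  \<open>F\<close>, and so their intersection would be dense in \<open>F\<close>; but it is empty,
  as the sets \<open>G\<close> cover \<open>F\<close>.\<close>

lemma Baire_relatively_open:
  fixes F :: "'a::{real_normed_vector,heine_borel} set"
  assumes "closed F" "F \<noteq> {}" "countable \<G>" "F \<subseteq> \<Union>\<G>" "\<And>G. G \<in> \<G> \<Longrightarrow> closed G"
  obtains G U where "G \<in> \<G>" "open U" "U \<inter> F \<noteq> {}" "U \<inter> F \<subseteq> G"
proof (rule ccontr)
  assume "\<not> thesis"
  with that have meets: "\<not> U \<inter> F \<subseteq> G" if "G \<in> \<G>" "open U" "U \<inter> F \<noteq> {}" for G U
    using that by blast
  have "F \<subseteq> closure (\<Inter>((\<lambda>G. F - G) ` \<G>))"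
  proof (rule Baire[OF \<open>closed F\<close>])
    fix T assume "T \<in> (\<lambda>G. F - G) ` \<G>"
    then obtain G where G: "G \<in> \<G>" "T = F - G"
      by blast
    have "openin (top_of_set F) (F - G)"
      using assms(5)[OF G(1)] by (auto simp: openin_open intro!: exI[of _ "- G"])
    moreover have "F \<subseteq> closure (F - G)"
    proof
      fix x assume "x \<in> F"
      show "x \<in> closure (F - G)"
        unfolding closure_iff_nhds_not_empty
      proof (intro allI impI)
        fix A V assume "V \<subseteq> A" "open V" "x \<in> V"
        then have "\<not> V \<inter> F \<subseteq> G"
          using meets[OF G(1)] \<open>x \<in> F\<close> by blast
        with \<open>V \<subseteq> A\<close> show "(F - G) \<inter> A \<noteq> {}"
          by blast
      qed
    qed
    ultimately show "openin (top_of_set F) T \<and> F \<subseteq> closure T"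
      unfolding G(2) by blast
  qed (use assms(3) in simp)
  moreover have "\<Inter>((\<lambda>G. F - G) ` \<G>) = {}"
    using assms(2,4) by blast
  ultimately show False
    using assms(2) by simp
qed

text \<open>All basic open sets meeting a compact positive subset in a null set are removed. Being
  countably many, they cost only a null set; and a basic neighbourhood inside an open set with null
  trace on the remainder would itself have been removed.\<close>

lemma compact_self_supporting:
  fixes S :: "'a::euclidean_space set"
  assumes S: "S \<in> sets lebesgue" "emeasure lebesgue S > 0"
  obtains F where "compact F" "F \<subseteq> S" "F \<noteq> {}"
    "\<And>U. \<lbrakk>open U; U \<inter> F \<noteq> {}\<rbrakk> \<Longrightarrow> U \<inter> F \<notin> null_sets lebesgue"
proof -
  obtain C where C: "compact C" "C \<subseteq> S" "emeasure lborel C > 0"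
    using positive_contains_compact[OF S] .
  obtain \<B> :: "'a set set" where \<B>: "countable \<B>" "\<And>B. B \<in> \<B> \<Longrightarrow> open B"
    "\<And>U. open U \<Longrightarrow> \<exists>\<B>'\<subseteq>\<B>. U = \<Union>\<B>'"
    using univ_second_countable by metis
  define W where "W = \<Union>{B \<in> \<B>. B \<inter> C \<in> null_sets lebesgue}"
  have "open W"
    unfolding W_def using \<B>(2) by (intro open_Union) auto
  have "(\<Union>B\<in>{B \<in> \<B>. B \<inter> C \<in> null_sets lebesgue}. B \<inter> C) \<in> null_sets lebesgue"
    using \<B>(1) by (intro null_sets_UN') auto
  also have "(\<Union>B\<in>{B \<in> \<B>. B \<inter> C \<in> null_sets lebesgue}. B \<inter> C) = W \<inter> C"
    unfolding W_def by blast
  finally have W: "W \<inter> C \<in> null_sets lebesgue" .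
  show ?thesis
  proof
    show "compact (C - W)"
      using C(1) \<open>open W\<close> by (rule compact_diff)
    show "C - W \<subseteq> S"
      using C(2) by blast
    show "C - W \<noteq> {}"
    proof
      assume "C - W = {}"
      then have "W \<inter> C = C"
        by blast
      with W C(1,3) show False
        by (auto simp: null_sets_def borel_compact)
    qed
    show "U \<inter> (C - W) \<notin> null_sets lebesgue" if U: "open U" "U \<inter> (C - W) \<noteq> {}" for U
    proof
      assume null: "U \<inter> (C - W) \<in> null_sets lebesgue"
      obtain x where x: "x \<in> U" "x \<in> C" "x \<notin> W"
        using U by blast
      then obtain B where B: "B \<in> \<B>" "x \<in> B" "B \<subseteq> U"
        using \<B>(3)[OF U(1)] by blast
      have "B \<inter> C \<subseteq> U \<inter> (C - W) \<union> W \<inter> C"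
        using B by blast
      then have "B \<inter> C \<in> null_sets lebesgue"
        by (rule null_sets_completion_subset) (intro null_sets.Un null W)
      then show False
        using B x unfolding W_def by blast
    qed
  qed
qed

text \<open>Singletons are null, so a cofinal family covers the line, which finitely many null sets
  cannot do. An infinite family absorbs countably many rational parameters without growing in
  cardinality.\<close>

lemma infinite_cofinal_null:
  assumes "\<A> \<subseteq> null_ideal" "\<And>N. N \<in> null_ideal \<Longrightarrow> \<exists>A\<in>\<A>. N \<subseteq> A"
  shows "infinite \<A>"
proof
  assume "finite \<A>"
  have "x \<in> \<Union>\<A>" for x
    using assms(2)[OF countable_lebesgue_null[of "{x}"]] by auto
  then have "\<Union>\<A> = UNIV"
    by blast
  moreover have "(\<Union>A\<in>\<A>. A) \<in> null_ideal"
    using \<open>finite \<A>\<close> assms(1) by (intro null_sets_UN' countable_finite) auto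
  ultimately show False
    by (simp add: null_sets_def)
qed

text \<open>
  For each member \<open>N\<close> of a cofinal family of null sets take a compact set \<open>F N\<close> avoiding \<open>N\<close>. If
  \<open>Y\<close> has positive measure then almost every point of the plane lies in a rational homothetic image
  of \<open>Y\<close>, so for a suitable \<open>N\<close> countably many of these cover the image of \<open>F N\<close>; by the Baire
  category theorem one of them contains the image of a portion of \<open>F N\<close>.
\<close>

lemma dense_family_of_positive_sets:
  obtains \<D> :: "(real \<times> real) set set" where "|\<D>| \<le>o cof_ideal null_ideal"
    "\<And>Y. \<lbrakk>Y \<in> sets lebesgue; emeasure lebesgue Y > 0\<rbrakk> \<Longrightarrow>
      \<exists>D\<in>\<D>. D \<subseteq> Y \<and> compact D \<and> D \<notin> null_sets lebesgue"
proof -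
  let ?cofinal = "{\<A>. \<A> \<subseteq> null_ideal \<and> (\<forall>N\<in>null_ideal. \<exists>A\<in>\<A>. N \<subseteq> A)}"
  have "null_ideal \<in> ?cofinal"
    by auto
  then have "?cofinal \<noteq> {}"
    by (rule ex_in_conv[THEN iffD1, OF exI])
  from min_card_is_minimum(1)[OF this] obtain \<A>
    where "\<A> \<in> ?cofinal" and card_\<A>: "cof_ideal null_ideal = |\<A>|"
    unfolding cof_ideal_def by (rule bexE)
  then have \<A>: "\<A> \<subseteq> null_ideal" "\<And>N. N \<in> null_ideal \<Longrightarrow> \<exists>A\<in>\<A>. N \<subseteq> A"
    by auto
  have "\<exists>F. compact F \<and> F \<subseteq> {0<..<1} - (N \<union> \<rat>) \<and> F \<noteq> {} \<and>
      (\<forall>U. open U \<and> U \<inter> F \<noteq> {} \<longrightarrow> U \<inter> F \<notin> null_ideal)" if "N \<in> \<A>" for N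
  proof -
    \<comment> \<open>Removing the rationals along with \<open>N\<close> makes
      \<open>to_square\<close> continuous on \<open>F N\<close>.\<close>
    have "N \<union> \<rat> \<in> null_ideal"
      using that \<A>(1) countable_lebesgue_null[OF countable_rat] by (intro null_sets.Un) auto
    then have "emeasure lebesgue ({0<..<1} - (N \<union> \<rat>)) = 1" "{0<..<1} - (N \<union> \<rat>) \<in> sets lebesgue"
      by (auto simp: emeasure_Diff_null_set)
    then obtain F where "compact F" "F \<subseteq> {0<..<1} - (N \<union> \<rat>)" "F \<noteq> {}"
        "\<And>U. \<lbrakk>open U; U \<inter> F \<noteq> {}\<rbrakk> \<Longrightarrow> U \<inter> F \<notin> null_sets lebesgue"
      using compact_self_supporting[of "{0<..<1} - (N \<union> \<rat>)"] by auto
    then show ?thesis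
      by blast
  qed
  then obtain F where F: "\<And>N. N \<in> \<A> \<Longrightarrow> compact (F N)"
    "\<And>N. N \<in> \<A> \<Longrightarrow> F N \<subseteq> {0<..<1} - (N \<union> \<rat>)" "\<And>N. N \<in> \<A> \<Longrightarrow> F N \<noteq> {}"
    "\<And>N U. \<lbrakk>N \<in> \<A>; open U; U \<inter> F N \<noteq> {}\<rbrakk> \<Longrightarrow> U \<inter> F N \<notin> null_ideal"
    by metis
  have cont: "continuous_on (F N) to_square" if "N \<in> \<A>" for N
    using F(2)[OF that] by (intro continuous_at_imp_continuous_on ballI isCont_to_square) auto
  let ?h = "\<lambda>c b (y :: real \<times> real). c *\<^sub>R y + b"
  let ?g = "\<lambda>c b (y :: real \<times> real). (1 / c) *\<^sub>R (y - b)"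
  \<comment> \<open>Each \<open>N\<close> yields countably many sets: \<open>(c, b)\<close> is a
    rational homothety to be undone, and \<open>u\<close>, \<open>v\<close> are rational ends of a
    portion of \<open>F N\<close>.\<close>
  define D where "D = (\<lambda>(N, (c, b), (u, v)). ?g c b ` to_square ` (F N \<inter> {u..v}))"
  define I :: "((real \<times> real \<times> real) \<times> real \<times> real) set" where "I = ((\<rat> - {0}) \<times> \<rat> \<times> \<rat>) \<times> \<rat> \<times> \<rat>"
  show ?thesis
  proof
    have "countable I"
      unfolding I_def by (intro countable_SIGMA countable_Diff countable_rat)
    then have "|I| \<le>o |UNIV :: nat set|"
      unfolding countable_def card_of_ordLeq[symmetric] by auto
    also have "|UNIV :: nat set| \<le>o |\<A>|"
      using infinite_cofinal_null[OF \<A>] unfolding infinite_iff_card_of_nat .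
    finally have "|I| \<le>o |\<A>|" .
    moreover have "(1, 0) \<in> (\<rat> - {0 :: real}) \<times> \<rat> \<times> \<rat>"
      by (simp add: zero_prod_def)
    then have "I \<noteq> {}"
      unfolding I_def by auto
    ultimately have "|\<A> \<times> I| =o |\<A>|"
      using card_of_Times_infinite_simps(1)[OF infinite_cofinal_null[OF \<A>]] by blast
    with card_of_image[of D "\<A> \<times> I"] show "|D ` (\<A> \<times> I)| \<le>o cof_ideal null_ideal"
      unfolding card_\<A> by (rule ordLeq_ordIso_trans)
    fix Y :: "(real \<times> real) set"
    assume Y: "Y \<in> sets lebesgue" "emeasure lebesgue Y > 0"
    obtain C where C: "compact C" "C \<subseteq> Y" "emeasure lborel C > 0"
      using positive_contains_compact[OF Y] .
    let ?H = "\<Union>c\<in>\<rat> - {0}. \<Union>b\<in>\<rat> \<times> \<rat>. ?h c b ` C"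
    \<comment> \<open>The rational copies of \<open>C\<close> miss a null set, whose preimage is
      null and so lies in some \<open>N\<close> of the cofinal family. For this \<open>N\<close>,
      \<open>to_square\<close> maps all of \<open>F N\<close> into the copies.\<close>
    have "{x \<in> {0..<1}. to_square x \<in> - ?H} \<in> null_ideal"
      by (intro null_vimage_to_square null_sets_completionI rational_homotheties_conull C)
    then obtain N where N: "N \<in> \<A>" "{x \<in> {0..<1}. to_square x \<in> - ?H} \<subseteq> N"
      using \<A>(2) by blast
    let ?G = "\<lambda>(c, b). {x \<in> F N. to_square x \<in> ?h c b ` C}"
    have closed_G: "closed {x \<in> F N. to_square x \<in> ?h c b ` C}" for c b
    proof -
      have "closed (?h c b ` C)"
        by (intro compact_imp_closed compact_continuous_image continuous_intros C)
      from continuous_closed_preimage[OF cont[OF N(1)] compact_imp_closed[OF F(1)[OF N(1)]] this]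
      show ?thesis
        by (simp add: Int_def vimage_def)
    qed
    have cover: "F N \<subseteq> \<Union>(?G ` ((\<rat> - {0}) \<times> \<rat> \<times> \<rat>))"
    proof
      fix x assume x: "x \<in> F N"
      then have "x \<in> {0..<1}" "x \<notin> N"
        using F(2)[OF N(1)] by auto
      then have "to_square x \<in> ?H"
        using N(2) by blast
      with x show "x \<in> \<Union>(?G ` ((\<rat> - {0}) \<times> \<rat> \<times> \<rat>))"
        by blast
    qed
    have countable: "countable (?G ` ((\<rat> - {0}) \<times> \<rat> \<times> \<rat>))"
      by (intro countable_image countable_SIGMA countable_Diff countable_rat)
    have closed: "closed G" if "G \<in> ?G ` ((\<rat> - {0}) \<times> \<rat> \<times> \<rat>)" for G
      using that closed_G by auto
    obtain G U where G: "G \<in> ?G ` ((\<rat> - {0}) \<times> \<rat> \<times> \<rat>)"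
        and U: "open U" "U \<inter> F N \<noteq> {}" "U \<inter> F N \<subseteq> G"
      by (rule Baire_relatively_open[OF compact_imp_closed[OF F(1)[OF N(1)]] F(3)[OF N(1)]
            countable cover closed])
    from G obtain c b where cb: "c \<in> \<rat> - {0}" "b \<in> \<rat> \<times> \<rat>" "G = {x \<in> F N. to_square x \<in> ?h c b ` C}"
      by blast
    obtain x where x: "x \<in> U" "x \<in> F N"
      using U by blast
    obtain e where e: "e > 0" "ball x e \<subseteq> U"
      using U(1) x(1) open_contains_ball by blast
    \<comment> \<open>The open set given by Baire is shrunk to an interval around \<open>x\<close>
      with rational ends, as the indexing of \<open>D\<close> requires.\<close>
    obtain u where u: "u \<in> \<rat>" "x - e < u" "u < x"
      using Rats_dense_in_real[of "x - e" x] e by auto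
    obtain v where v: "v \<in> \<rat>" "x < v" "v < x + e"
      using Rats_dense_in_real[of x "x + e"] e by auto
    have "{u..v} \<subseteq> ball x e"
      using u v by (auto simp: dist_real_def)
    then have uv: "{u..v} \<subseteq> U"
      using e by blast
    let ?D = "?g c b ` to_square ` (F N \<inter> {u..v})"
    have "?D = D (N, (c, b), (u, v))"
      unfolding D_def by simp
    moreover have "(N, (c, b), (u, v)) \<in> \<A> \<times> I"
      unfolding I_def using N cb u v by blast
    ultimately have "?D \<in> D ` (\<A> \<times> I)"
      by blast
    moreover have "?D \<subseteq> Y"
    proof
      fix z assume "z \<in> ?D"
      then obtain t where t: "t \<in> F N \<inter> {u..v}" "z = ?g c b (to_square t)"
        by blast
      then have "to_square t \<in> ?h c b ` C"
        using uv U(3) unfolding cb by blast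
      then show "z \<in> Y"
        using t(2) cb(1) C(2) by auto
    qed
    moreover have "compact ?D"
      by (intro compact_continuous_image continuous_intros compact_Int F(1) N
          continuous_on_subset[OF cont[OF N(1)]]) auto
    moreover have "?D \<notin> null_sets lebesgue"
    proof
      assume null: "?D \<in> null_sets lebesgue"
      \<comment> \<open>If \<open>?D\<close> were null, so would be its homothetic copy and the
        preimage of that under \<open>to_square\<close>. This preimage contains a nonempty portion
        of \<open>F N\<close>, against the choice of \<open>F N\<close>.\<close>
      have hD: "?h c b ` ?D = to_square ` (F N \<inter> {u..v})"
        unfolding image_image using cb(1) by simp
      have "compact (?h c b ` ?D)"
        by (intro compact_continuous_image continuous_intros \<open>compact ?D\<close>)
      moreover have "emeasure lebesgue (?h c b ` ?D) = 0"
        unfolding emeasure_lebesgue_affine using null by (simp add: null_sets_def)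
      ultimately have "?h c b ` ?D \<in> null_sets lebesgue"
        by (auto simp: null_sets_def borel_compact)
      then have "{x \<in> {0..<1}. to_square x \<in> to_square ` (F N \<inter> {u..v})} \<in> null_ideal"
        unfolding hD by (rule null_vimage_to_square)
      then have "{u<..<v} \<inter> F N \<in> null_ideal"
      proof (rule null_sets_completion_subset[rotated])
        show "{u<..<v} \<inter> F N \<subseteq> {x \<in> {0..<1}. to_square x \<in> to_square ` (F N \<inter> {u..v})}"
          using F(2)[OF N(1)] by auto
      qed
      moreover have "{u<..<v} \<inter> F N \<noteq> {}"
        using x u v by auto
      ultimately show False
        using F(4)[OF N(1) open_greaterThanLessThan] by blast
    qed
    ultimately show "\<exists>D'\<in>D ` (\<A> \<times> I). D' \<subseteq> Y \<and> compact D' \<and> D' \<notin> null_sets lebesgue"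
      by (intro bexI[of _ ?D] conjI)
  qed
qed

subsection \<open>Full sets avoiding rational distances\<close>

text \<open>Let \<open>E\<close> be a measurable envelope of \<open>A\<close> and \<open>H\<close> a
  measurable hull of \<open>X \<inter> B\<close>. If \<open>(X - H) \<inter> E\<close> were
  positive, it would contain a member \<open>D\<close> of the dense family; inside the envelope
  \<open>A \<inter> D\<close> is not null, so \<open>B\<close> meets \<open>D\<close>, yet
  \<open>B\<close> has no point in \<open>X - H\<close>. Hence \<open>H\<close> covers
  \<open>X \<inter> A\<close> up to a null set.\<close>

lemma full_in_if_meets_dense:
  fixes A B :: "(real \<times> real) set"
  assumes "B \<subseteq> A"
    and dense: "\<And>Y. \<lbrakk>Y \<in> sets lebesgue; emeasure lebesgue Y > 0\<rbrakk> \<Longrightarrow>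
      \<exists>D\<in>\<D>. D \<subseteq> Y \<and> compact D \<and> D \<notin> null_sets lebesgue"
    and meets: "\<And>D. \<lbrakk>D \<in> \<D>; D \<in> sets lebesgue; A \<inter> D \<notin> null_sets lebesgue\<rbrakk> \<Longrightarrow> B \<inter> D \<noteq> {}"
  shows "full_in A B"
  unfolding full_in_def
proof (intro conjI ballI impI antisym)
  obtain E where E: "measurable_envelope lebesgue A E"
  proof -
    have "A \<subseteq> (\<Union>n::nat. cball 0 (real n))"
      by (auto simp: real_arch_simple)
    then have "\<exists>E\<subseteq>(\<Union>n::nat. cball 0 (real n)). measurable_envelope lebesgue A E"
      by (rule measurable_envelopeI_countable_cover) (use emeasure_bounded_finite[OF bounded_cball] in auto)
    then show ?thesis
      using that by blast
  qed
  note envelope = measurable_envelopeD[OF E]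
  fix X :: "(real \<times> real) set"
  assume X: "X \<in> sets lebesgue"
  show "outer_measure_of lebesgue (X \<inter> B) \<le> outer_measure_of lebesgue (X \<inter> A)"
    using \<open>B \<subseteq> A\<close> by (intro outer_measure_of_mono) auto
  obtain H where H: "H \<in> sets lebesgue" "X \<inter> B \<subseteq> H" "outer_measure_of lebesgue (X \<inter> B) = emeasure lebesgue H"
    using outer_measure_of_attain[of "X \<inter> B" lebesgue] by auto
  have XE: "(X - H) \<inter> E \<in> sets lebesgue"
    using X H envelope(2) by auto
  have "emeasure lebesgue ((X - H) \<inter> E) = 0"
  proof (rule ccontr)
    assume "emeasure lebesgue ((X - H) \<inter> E) \<noteq> 0"
    then obtain D where D: "D \<in> \<D>" "D \<subseteq> (X - H) \<inter> E" "compact D" "D \<notin> null_sets lebesgue"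
      using dense[OF XE] by (auto simp: zero_less_iff_neq_zero)
    have D_sets: "D \<in> sets lebesgue"
      using D(3) by (simp add: borel_compact)
    have "D \<inter> E = D"
      using D(2) by blast
    then have "emeasure lebesgue D = outer_measure_of lebesgue (A \<inter> D)"
      using envelope(3)[OF D_sets] by (simp add: Int_commute)
    then have "A \<inter> D \<notin> null_sets lebesgue"
      using D(4) D_sets by (auto simp: null_sets_def)
    from meets[OF D(1) D_sets this] show False
      using D(2) H(2) by blast
  qed
  then have "outer_measure_of lebesgue ((X - H) \<inter> A) = 0"
    using envelope(3)[of "X - H"] X H by auto
  moreover obtain N where N: "N \<in> sets lebesgue" "(X - H) \<inter> A \<subseteq> N" "outer_measure_of lebesgue ((X - H) \<inter> A) = emeasure lebesgue N"
    using outer_measure_of_attain[of "(X - H) \<inter> A" lebesgue] by auto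
  ultimately have "emeasure lebesgue (H \<union> N) \<le> emeasure lebesgue H"
    using H emeasure_subadditive[of H lebesgue N] by simp
  moreover have "outer_measure_of lebesgue (X \<inter> A) \<le> outer_measure_of lebesgue (H \<union> N)"
    using N by (intro outer_measure_of_mono) auto
  ultimately show "outer_measure_of lebesgue (X \<inter> A) \<le> outer_measure_of lebesgue (X \<inter> B)"
    using H N by simp
qed (fact assms(1))

section \<open>Transfinite choice of the points\<close>

theorem theorem3p2:
  fixes A :: "(real \<times> real) set"
  assumes "non_ideal UNIV null_ideal =o cof_ideal null_ideal"
    and "outer_measure_of lebesgue A > 0"
  shows "\<exists>f. partial_bijection_in A f \<and> avoids_rational_distances f \<and> full_in A f"
proof -
  obtain \<D>' :: "(real \<times> real) set set" where card_\<D>': "|\<D>'| \<le>o cof_ideal null_ideal"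
    and dense: "\<And>Y. \<lbrakk>Y \<in> sets lebesgue; emeasure lebesgue Y > 0\<rbrakk> \<Longrightarrow>
      \<exists>D\<in>\<D>'. D \<subseteq> Y \<and> compact D \<and> D \<notin> null_sets lebesgue"
    by (rule dense_family_of_positive_sets) (blast intro: that)
  obtain U where U: "small U"
    "\<And>T D. \<lbrakk>small T; T \<inter> U = {}; D \<in> sets lebesgue; A \<inter> D \<notin> null_sets lebesgue\<rbrakk>
      \<Longrightarrow> {x \<in> A \<inter> D. \<forall>t\<in>T. dist x t \<notin> \<rat>} \<notin> null_sets lebesgue"
    by (rule exceptional_small_set[of A]) (blast intro: that)
  define \<D> where "\<D> = {D \<in> \<D>'. D \<in> sets lebesgue \<and> A \<inter> D \<notin> null_sets lebesgue}"
  \<comment> \<open>The cardinal \<open>|\<D>|\<close> is a well-order of least type on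
    \<open>\<D>\<close>, so each element has fewer than \<open>|\<D>|\<close> strict
    predecessors.\<close>
  define R where "R = {(C, D). C \<in> underS |\<D>| D}"
  have "wf R"
  proof (rule wf_subset)
    show "wf ( |\<D>| - Id)"
      using card_of_Well_order[of \<D>] unfolding well_order_on_def by blast
  qed (auto simp: R_def underS_def)
  \<comment> \<open>Here non(N) = cof(N) enters: fewer than cof(N) earlier stages are fewer than
    non(N).\<close>
  have small_before: "small {C. (C, D) \<in> R}" if "D \<in> \<D>" for D
  proof -
    have "| {C. (C, D) \<in> R} | <o |\<D>|"
      using card_of_underS[OF card_of_Card_order, of D \<D>] that by (simp add: R_def Field_card_of)
    also have "|\<D>| \<le>o |\<D>'|"
      unfolding \<D>_def by (rule card_of_mono1) auto
    also note card_\<D>'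
    also have "cof_ideal null_ideal =o non_ideal UNIV null_ideal"
      using assms(1) by (rule ordIso_symmetric)
    finally show ?thesis
      unfolding small_def .
  qed
  have R_field: "C \<in> \<D>" if "(C, D) \<in> R" for C D
    using that Field_card_of[of \<D>] unfolding R_def underS_def Field_def by auto
  \<comment> \<open>Indices outside \<open>\<D>\<close> carry no demand, so the choice function is
    total. Avoiding \<open>U\<close> keeps the earlier points disjoint from it at every later
    stage.\<close>
  define P where "P = (\<lambda>p D x. D \<in> \<D> \<longrightarrow> x \<in> A \<inter> D - U \<and>
    (\<forall>C. (C, D) \<in> R \<longrightarrow> fst x \<noteq> fst (p C) \<and> snd x \<noteq> snd (p C) \<and> dist x (p C) \<notin> \<rat>))"
  have "\<exists>p. \<forall>D. P p D (p D)"
  proof (rule dependent_wf_choice[OF \<open>wf R\<close>])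
    show "P p D x = P q D x" if "\<And>C. (C, D) \<in> R \<Longrightarrow> p C = q C" for p q D x
      using that unfolding P_def by auto
    fix D p
    assume before: "\<And>C. (C, D) \<in> R \<Longrightarrow> P p C (p C)"
    show "\<exists>x. P p D x"
    proof (cases "D \<in> \<D>")
      case True
      let ?T = "p ` {C. (C, D) \<in> R}"
      have T: "small ?T" "?T \<inter> U = {}"
        using before R_field small_before[OF True] by (auto simp: P_def small_image)
      let ?free = "{x \<in> A \<inter> D. \<forall>t\<in>?T. dist x t \<notin> \<rat>}"
      \<comment> \<open>The earlier points have small, hence null, projections, so
        \<open>?bad\<close> is null and cannot exhaust the non-null set
        \<open>?free\<close>.\<close>
      let ?bad = "U \<union> fst -` fst ` ?T \<union> snd -` snd ` ?T"
      have free: "?free \<notin> null_sets lebesgue"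
        using True by (intro U(2) T) (auto simp: \<D>_def)
      have bad: "?bad \<in> null_sets lebesgue"
        by (intro null_sets.Un small_plane_null U(1) null_vimage_fst_snd small_real_null small_image[of ?T] T(1))
      have "\<not> ?free \<subseteq> ?bad"
      proof
        assume "?free \<subseteq> ?bad"
        from null_sets_completion_subset[OF this bad] free show False
          by contradiction
      qed
      then obtain x where x: "x \<in> ?free" "x \<notin> ?bad"
        unfolding subset_iff not_all not_imp by (elim exE conjE)
      have "x \<notin> U" "fst x \<notin> fst ` ?T" "snd x \<notin> snd ` ?T"
        using x(2) unfolding Un_iff vimage_eq de_Morgan_disj by simp_all
      then have "fst x \<noteq> fst (p C)" "snd x \<noteq> snd (p C)" if "(C, D) \<in> R" for C
        using that unfolding image_image by auto
      then show ?thesis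
        unfolding P_def using x(1) \<open>x \<notin> U\<close> by (intro exI[of _ x]) simp
    qed (simp add: P_def)
  qed
  then obtain p where p: "\<And>D. P p D (p D)"
    by blast
  have apart: "fst (p C) \<noteq> fst (p D) \<and> snd (p C) \<noteq> snd (p D) \<and> dist (p C) (p D) \<notin> \<rat>"
    if "C \<in> \<D>" "D \<in> \<D>" "C \<noteq> D" for C D
  proof -
    \<comment> \<open>Of two distinct members one comes later, and its point was chosen to avoid the
      other; the demands are symmetric.\<close>
    have "(C, D) \<in> |\<D>| \<or> (D, C) \<in> |\<D>|"
      using card_of_Well_order[of \<D>] that
      by (auto simp: well_order_on_def linear_order_on_def total_on_def Field_card_of)
    then have "(C, D) \<in> R \<or> (D, C) \<in> R"
      using that unfolding R_def underS_def by auto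
    then show ?thesis
      using p[of C] p[of D] that unfolding P_def by (metis dist_commute)
  qed
  define f where "f = p ` \<D>"
  have f_sub: "f \<subseteq> A"
    using p unfolding f_def P_def by blast
  have inj: "inj_on fst f" "inj_on snd f"
    using apart unfolding f_def inj_on_def by blast+
  have "partial_bijection_in A f"
    unfolding partial_bijection_in_def
  proof (intro exI conjI)
    let ?g = "\<lambda>x. snd (the_inv_into f fst x)"
    have g: "?g (fst q) = snd q" if "q \<in> f" for q
      using the_inv_into_f_f[OF inj(1) that] by simp
    show "inj_on ?g (fst ` f)"
      using inj(2) g unfolding inj_on_def by auto
    show "f = {(x, ?g x) | x. x \<in> fst ` f}"
      using g by (force simp: image_iff)
  qed (rule f_sub)
  moreover have "avoids_rational_distances f"
    using apart unfolding avoids_rational_distances_def f_def by blast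
  moreover have "full_in A f"
  proof (rule full_in_if_meets_dense[OF f_sub dense])
    fix D assume "D \<in> \<D>'" "D \<in> sets lebesgue" "A \<inter> D \<notin> null_sets lebesgue"
    then have "D \<in> \<D>"
      unfolding \<D>_def by blast
    then have "p D \<in> f \<inter> D"
      using p[of D] unfolding f_def P_def by blast
    then show "f \<inter> D \<noteq> {}"
      by blast
  qed
  ultimately show ?thesis
    by blast
qed

end
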